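(* Let $0\leq t_1<\cdots<t_{n+1}<2\pi$, $z_k=e^{it_k}$, $\beta_k\in\mathbb{R}$ for $k=1,\ldots,n+1$, and suppose that $$\sum_{k=1}^{n+1}\beta_k=1,\qquad \sum_{k=1}^{n+1}|\beta_k|\leq 2.$$ Then the function $f$, analytic in the unit disk $\mathbb{D}$ and defined (up to an additive constant) by $$f'(z)=a\prod_{k=1}^{n+1}(z-z_k)^{-2\beta_k},\qquad a\in\mathbb{C},\ a\neq 0,$$ is univalent in $\mathbb{D}$.
   Context: $\mathbb{D}=\{|z|<1\}$. Each power $(z-z_k)^{-2\beta_k}$ denotes a fixed analytic branch in $\mathbb{D}$; the choice of branches only changes the nonzero constant $a$. Univalent means injective. *)

theory Defs
  imports "HOL-Complex_Analysis.Complex_Analysis"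
begin

text \<open>
  The function \<open>g\<close> is an analytic branch on \<open>S\<close> of the power \<open>h\<^sup>c\<close>: it is
  \<open>exp (c \<cdot> L)\<close> for some analytic branch \<open>L\<close> of \<open>log h\<close> on \<open>S\<close>.  The library power \<open>powr\<close>
  is not used because it always takes the principal logarithm, so \<open>(z - w) powr c\<close> is in general
  discontinuous on the unit disk when \<open>w\<close> is on the unit circle.
\<close>

definition power_branch_on ::
  "complex set \<Rightarrow> (complex \<Rightarrow> complex) \<Rightarrow> real \<Rightarrow> (complex \<Rightarrow> complex) \<Rightarrow> bool" where
  "power_branch_on S h c g \<longleftrightarrow>
     (\<exists>L. L analytic_on S \<and> (\<forall>z\<in>S. exp (L z) = h z) \<and>
          (\<forall>z\<in>S. g z = exp (complex_of_real c * L z)))"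

end

theory Submission
  imports Defs
begin

text \<open>
  The function \<open>f\<close> is close-to-convex. Let \<open>P\<close> be the sum of the positive parts \<open>\<beta>\<^sub>k\<^sup>+\<close>; the
  hypotheses give \<open>1 \<le> P \<le> 3/2\<close>. Put \<open>\<gamma>\<^sub>k = \<beta>\<^sub>k\<^sup>+ / P\<close> and let \<open>g'\<close> be the product of the
  \<open>(z - z\<^sub>k)\<close> to the powers \<open>- 2 \<gamma>\<^sub>k\<close>, so that \<open>g\<close> is convex. The quotient \<open>f' / g'\<close> is a weighted
  product of ratios \<open>(z - z\<^sub>k) / (z - z\<^sub>j)\<close> of total weight \<open>2 P - 2 \<le> 1\<close>. Each ratio maps the disk
  into an open half-plane with \<open>0\<close> on its boundary, hence so does \<open>f' / g'\<close>.

  To avoid the geometry of convex images, \<open>f a \<noteq> f b\<close> is reduced to \<open>a = 0\<close> by a disk automorphism,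
  which preserves the form of \<open>g'\<close> because the \<open>\<gamma>\<^sub>k\<close> sum to 1. With \<open>f 0 = g 0 = 0\<close>, looking at a
  point of minimal modulus where the real part fails to be positive gives first
  \<open>Re (g / (z g')) > 0\<close> and then Libera's inequality \<open>Re (f / g) > 0\<close>.
\<close>

section \<open>Jack's lemma and close-to-convex functions at the origin\<close>

text \<open>
  Jack's lemma in the half-plane setting: at \<open>z\<close>, the function \<open>Re q\<close> is minimal on the closed
  disk of radius \<open>|z|\<close>.
\<close>
lemma min_norm_nonpositive_Re:
  assumes q: "\<And>z. z \<in> ball 0 1 \<Longrightarrow> (q has_field_derivative q' z) (at z)"
    and q0: "Re (q 0) > 0"
    and z1: "z1 \<in> ball 0 1" "Re (q z1) \<le> 0"
  obtains z m where "z \<in> ball 0 1" "Re (q z) = 0" "m \<ge> 0" "z * q' z = - complex_of_real m"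
proof -
  define K where "K = {z \<in> cball 0 (norm z1). Re (q z) \<le> 0}"
  have sub: "cball 0 (norm z1) \<subseteq> ball (0::complex) 1"
    using z1 by auto
  have contq: "continuous_on (ball 0 1) q"
    using q by (meson DERIV_isCont continuous_at_imp_continuous_on)
  have "continuous_on (cball 0 (norm z1)) (\<lambda>z. Re (q z))"
    by (intro continuous_intros continuous_on_subset[OF contq sub])
  then have "closed K"
    unfolding K_def by (rule continuous_on_closed_Collect_le) auto
  moreover have "bounded K"
    unfolding K_def by (rule bounded_subset[OF bounded_cball[of 0 "norm z1"]]) auto
  ultimately have "compact K" by (simp add: compact_eq_bounded_closed)
  moreover have "z1 \<in> K" using z1 by (auto simp: K_def)
  ultimately obtain w where w: "w \<in> K" and wmin: "\<And>y. y \<in> K \<Longrightarrow> norm w \<le> norm y"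
    using continuous_attains_inf[of K norm] continuous_on_norm_id by blast
  have wb: "w \<in> ball 0 1" and Rw: "Re (q w) \<le> 0"
    using w sub by (auto simp: K_def)
  have inner: "Re (q y) > 0" if "norm y < norm w" for y
    using wmin[of y] that w by (force simp: K_def)
  \<comment> \<open>The directions \<open>- w * u\<close> with \<open>Re u > 0\<close> point
    strictly into the disk of radius \<open>norm w\<close>. Along them \<open>Re q\<close> is
    positive near \<open>w\<close>, so by continuity it is \<open>0\<close> at \<open>w\<close>, and
    its derivative there is nonnegative.\<close>
  have direction: "Re (q w) = 0 \<and> Re (- w * q' w * u) \<ge> 0" if u: "Re u > 0" for u
  proof -
    define \<rho> where "\<rho> t = Re (q (w - of_real t * (w * u)))" for t
    have d: "(\<rho> has_real_derivative Re (- w * q' w * u)) (at 0)"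
    proof -
      have "((\<lambda>t. q (w - t * (w * u))) has_field_derivative q' w * (- (w * u))) (at 0)"
        by (rule DERIV_chain2[where f=q]) (use q[OF wb] in \<open>auto intro!: derivative_eq_intros\<close>)
      then have "((\<lambda>t. q (w - of_real t * (w * u))) has_vector_derivative q' w * (- (w * u))) (at 0)"
        using has_vector_derivative_real_field[of "\<lambda>t. q (w - t * (w * u))" _ 0 UNIV] by simp
      then have "((\<lambda>t. Re (q (w - of_real t * (w * u)))) has_vector_derivative Re (q' w * (- (w * u)))) (at 0)"
        by (rule bounded_linear.has_vector_derivative[OF bounded_linear_Re])
      then show ?thesis
        by (simp add: \<rho>_def[abs_def] has_real_derivative_iff_has_vector_derivative algebra_simps)
    qed
    have u0: "u \<noteq> 0" using u by auto
    have w0: "w \<noteq> 0" using Rw q0 by auto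
    \<comment> \<open>Expanding the square shows that, for \<open>t > 0\<close>,
      \<open>norm (1 - t * u) < 1\<close> holds exactly when \<open>t < T\<close>.\<close>
    define T where "T = 2 * Re u / (norm u)\<^sup>2"
    have T: "T > 0" using u u0 by (simp add: T_def)
    have pos: "\<rho> t > 0" if t: "0 < t" "t < T" for t
    proof -
      have "(norm (1 - of_real t * u))\<^sup>2 = 1 - t * (2 * Re u - t * (norm u)\<^sup>2)"
        unfolding cmod_power2 by (simp add: power2_eq_square algebra_simps)
      also have "\<dots> < 1"
        using t u0 by (simp add: T_def field_simps)
      finally have "norm (1 - of_real t * u) < 1"
        by (simp add: power_less_one_iff)
      then have "norm (w * (1 - of_real t * u)) < norm w"
        using w0 by (simp add: norm_mult)
      then show ?thesis unfolding \<rho>_def by (intro inner) (simp add: algebra_simps)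
    qed
    have "\<rho> 0 \<ge> 0"
    proof (rule tendsto_lowerbound)
      show "(\<rho> \<longlongrightarrow> \<rho> 0) (at_right 0)"
        using DERIV_isCont[OF d] by (simp add: isCont_def filterlim_at_split)
      show "\<forall>\<^sub>F t in at_right 0. 0 \<le> \<rho> t"
        using eventually_at_right_real[OF T] by eventually_elim (use pos in force)
    qed simp
    then have R0: "Re (q w) = 0" using Rw by (simp add: \<rho>_def)
    have "Re (- w * q' w * u) \<ge> 0"
    proof (rule ccontr)
      assume "\<not> ?thesis"
      then obtain e where e: "e > 0" "\<And>h. 0 < h \<Longrightarrow> h < e \<Longrightarrow> \<rho> (0 + h) < \<rho> 0"
        using DERIV_neg_dec_right[OF d] by auto
      have "\<rho> (min e T / 2) < \<rho> 0" using e(2)[of "min e T / 2"] e(1) T by auto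
      moreover have "\<rho> (min e T / 2) > 0" using pos[of "min e T / 2"] e(1) T by auto
      ultimately show False using R0 by (simp add: \<rho>_def)
    qed
    with R0 show ?thesis by simp
  qed
  define p where "p = - w * q' w"
  have Rp: "Re p \<ge> 0" using direction[of 1] by (simp add: p_def)
  have "Im p = 0"
  proof (rule ccontr)
    assume I: "Im p \<noteq> 0"
    have "Re (p * u) \<ge> 0" if "Re u > 0" for u
      using direction[OF that] by (simp add: p_def)
    \<comment> \<open>This \<open>u\<close> gives
      \<open>Re (p * u) = Re p - (Re p + 1) = - 1\<close>.\<close>
    from this[of "Complex 1 ((Re p + 1) / Im p)"] show False using I by simp
  qed
  then have "p = of_real (Re p)" by (simp add: complex_eq_iff)
  then have "w * q' w = - of_real (Re p)" unfolding p_def by (metis minus_minus mult_minus_left)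
  then show ?thesis
    using that wb Rp direction[of 1] by auto
qed

lemma holomorphic_divided_difference_0:
  assumes "f holomorphic_on ball 0 1"
  obtains h where "h holomorphic_on ball 0 1" "\<And>z. z \<in> ball 0 1 \<Longrightarrow> f z - f 0 = z * h z"
proof
  show "(\<lambda>z. if z = 0 then deriv f 0 else (f z - f 0) / (z - 0)) holomorphic_on ball 0 1"
    by (rule pole_lemma_open) (use assms in auto)
qed auto

text \<open>The minimum-modulus lemma is applied twice: to \<open>S\<close>, which makes
  \<open>g\<close> starlike about \<open>g 0\<close>, and then to \<open>Q\<close>, the quotient of
  \<open>f - f 0\<close> by \<open>g - g 0\<close>. Positivity of \<open>Re Q\<close> excludes a
  second zero of \<open>f - f 0\<close>.\<close>

lemma close_to_convex_value_at_0:
  assumes f: "\<And>z. z \<in> ball 0 1 \<Longrightarrow> (f has_field_derivative f' z) (at z)"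
    and g: "\<And>z. z \<in> ball 0 1 \<Longrightarrow> (g has_field_derivative g' z) (at z)"
    and g': "\<And>z. z \<in> ball 0 1 \<Longrightarrow> (g' has_field_derivative g'' z) (at z)"
    and nz: "\<And>z. z \<in> ball 0 1 \<Longrightarrow> g' z \<noteq> 0"
    and convex: "\<And>z. z \<in> ball 0 1 \<Longrightarrow> Re (1 + z * g'' z / g' z) > 0"
    and close: "\<And>z. z \<in> ball 0 1 \<Longrightarrow> Re (f' z / g' z) > 0"
    and z: "z \<in> ball 0 1" "z \<noteq> 0"
  shows "f z \<noteq> f 0"
proof -
  have "f holomorphic_on ball 0 1" "g holomorphic_on ball 0 1"
    using f g by (meson holomorphic_on_open open_ball)+
  then obtain f1 g1 where f1: "f1 holomorphic_on ball 0 1" "\<And>z. z \<in> ball 0 1 \<Longrightarrow> f z - f 0 = z * f1 z"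
    and g1: "g1 holomorphic_on ball 0 1" "\<And>z. z \<in> ball 0 1 \<Longrightarrow> g z - g 0 = z * g1 z"
    by (metis holomorphic_divided_difference_0)
  have df1: "(f1 has_field_derivative deriv f1 x) (at x)"
    and dg1: "(g1 has_field_derivative deriv g1 x) (at x)" if "x \<in> ball 0 1" for x
    using f1(1) g1(1) that holomorphic_derivI open_ball by blast+
  have product: "d = k1 x + x * deriv k1 x"
    if "(k has_field_derivative d) (at x)" "(k1 has_field_derivative deriv k1 x) (at x)"
      and k1: "\<And>x. x \<in> ball 0 1 \<Longrightarrow> k x - k 0 = x * k1 x" and x: "x \<in> ball 0 1"
    for k k1 :: "complex \<Rightarrow> complex" and x d
  proof -
    have "((\<lambda>x. k 0 + x * k1 x) has_field_derivative k1 x + x * deriv k1 x) (at x)"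
      using DERIV_add[OF DERIV_const DERIV_mult[OF DERIV_ident that(2)], of "k 0"]
      by (simp add: algebra_simps)
    moreover have "k 0 + y * k1 y = k y" if "y \<in> ball 0 1" for y
      unfolding k1[OF that, symmetric] by simp
    ultimately have "(k has_field_derivative k1 x + x * deriv k1 x) (at x)"
      by (rule has_field_derivative_transform_within_open[OF _ open_ball x])
    with that(1) show ?thesis by (rule DERIV_unique)
  qed
  have f'_eq: "f' x = f1 x + x * deriv f1 x" and g'_eq: "g' x = g1 x + x * deriv g1 x"
    if "x \<in> ball 0 1" for x
    using product[OF f df1 f1(2), of x] product[OF g dg1 g1(2), of x] that by simp_all
  \<comment> \<open>\<open>S\<close> is \<open>(g - g 0) / (z g')\<close>, which unlike its reciprocal has no poles a priori.\<close>
  define S where "S x = g1 x / g' x" for x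
  define S' where "S' x = (deriv g1 x * g' x - g1 x * g'' x) / (g' x * g' x)" for x
  have dS: "(S has_field_derivative S' x) (at x)" if "x \<in> ball 0 1" for x
    unfolding S_def[abs_def] S'_def
    by (rule DERIV_divide) (use dg1 g' nz that in auto)
  \<comment> \<open>This is the derivative of \<open>x * S = (g - g 0) / g'\<close>,
    rearranged.\<close>
  have eqS: "(1 + x * g'' x / g' x) * S x = 1 - x * S' x" if "x \<in> ball 0 1" for x
  proof -
    have "g' x * g' x = g' x * g1 x + x * (g' x * deriv g1 x)"
      using g'_eq[OF that] by (metis distrib_left mult.left_commute)
    then have num: "g' x * g' x - x * (deriv g1 x * g' x - g1 x * g'' x) = (g' x + x * g'' x) * g1 x"
      by (simp add: algebra_simps)
    have "1 - x * S' x = (g' x * g' x - x * (deriv g1 x * g' x - g1 x * g'' x)) / (g' x * g' x)"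
      using nz[OF that] by (simp add: S'_def diff_divide_distrib[of "g' x * g' x"])
    also have "\<dots> = (g' x + x * g'' x) / g' x * (g1 x / g' x)"
      unfolding num by simp
    also have "\<dots> = (1 + x * g'' x / g' x) * S x"
      using nz[OF that] by (simp add: S_def add_divide_distrib)
    finally show ?thesis by simp
  qed
  have S0: "S 0 = 1" using g'_eq[of 0] nz[of 0] by (simp add: S_def)
  have ReS: "Re (S x) > 0" if x: "x \<in> ball 0 1" for x
  proof (rule ccontr)
    assume "\<not> ?thesis"
    then obtain y m where y: "y \<in> ball 0 1" "Re (S y) = 0" "m \<ge> 0" "y * S' y = - complex_of_real m"
      using min_norm_nonpositive_Re[of S S' x] dS S0 x by auto
    \<comment> \<open>\<open>S y\<close> is purely imaginary and \<open>P * S y = 1 + m\<close> is a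
      nonzero real, so \<open>P\<close> would be purely imaginary too, against convexity.\<close>
    define P where "P = 1 + y * g'' y / g' y"
    have P: "Re P > 0" using convex[OF y(1)] by (simp add: P_def)
    have "P * S y = of_real (1 + m)" using eqS[OF y(1)] y(4) by (simp add: P_def)
    then have "Re (P * S y) = 1 + m" "Im (P * S y) = 0" by (simp_all del: of_real_add)
    then have "- Im P * Im (S y) = 1 + m" "Re P * Im (S y) = 0" using y(2) by auto
    then show False using P y(3) by auto
  qed
  have g1nz: "g1 x \<noteq> 0" if "x \<in> ball 0 1" for x
    using ReS[OF that] by (auto simp: S_def)
  define Q where "Q x = f1 x / g1 x" for x
  define Q' where "Q' x = (deriv f1 x * g1 x - f1 x * deriv g1 x) / (g1 x * g1 x)" for x
  have dQ: "(Q has_field_derivative Q' x) (at x)" if "x \<in> ball 0 1" for x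
    unfolding Q_def[abs_def] Q'_def
    by (rule DERIV_divide) (use dg1 df1 g1nz that in auto)
  \<comment> \<open>Differentiate \<open>f - f 0 = Q * (g - g 0)\<close> and divide by
    \<open>g'\<close>, using \<open>(g - g 0) / g' = x * S\<close>.\<close>
  have eqQ: "f' x / g' x = Q x + x * Q' x * S x" if "x \<in> ball 0 1" for x
  proof -
    have "Q x + x * Q' x * S x = (f1 x * g' x + x * (deriv f1 x * g1 x - f1 x * deriv g1 x)) / (g1 x * g' x)"
      using g1nz[OF that] nz[OF that] by (simp add: Q_def Q'_def S_def field_simps)
    also have "\<dots> = g1 x * f' x / (g1 x * g' x)"
      unfolding g'_eq[OF that] f'_eq[OF that] by (simp add: algebra_simps)
    finally show ?thesis using g1nz[OF that] by simp
  qed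
  have ReQ: "Re (Q x) > 0" if x: "x \<in> ball 0 1" for x
  proof (rule ccontr)
    assume "\<not> ?thesis"
    moreover have "Re (Q 0) > 0" using close[of 0] eqQ[of 0] by simp
    ultimately obtain y m where y: "y \<in> ball 0 1" "Re (Q y) = 0" "m \<ge> 0" "y * Q' y = - complex_of_real m"
      using min_norm_nonpositive_Re[of Q Q' x] dQ x by (metis linorder_not_less)
    \<comment> \<open>Here \<open>Q y\<close> contributes no real part, and \<open>- m * S y\<close>
      has the wrong sign because \<open>Re S > 0\<close>.\<close>
    have "Re (f' y / g' y) = - m * Re (S y)"
      unfolding eqQ[OF y(1)] y(4) using y(2) by simp
    moreover have "m * Re (S y) \<ge> 0" using y(3) ReS[OF y(1)] by simp
    ultimately show False using close[OF y(1)] by simp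
  qed
  have "f1 z \<noteq> 0" using ReQ[OF z(1)] by (auto simp: Q_def)
  then show ?thesis using f1(2)[OF z(1)] z(2) by auto
qed

section \<open>Arguments of products of boundary factors\<close>

text \<open>The quotient is \<open>1 / (1 - z / v)\<close>, and \<open>1 / (1 - s)\<close> maps the
  unit disk onto the half-plane \<open>Re > 1 / 2\<close>.\<close>

lemma Re_unit_div_diff:
  assumes "norm v = 1" "norm z < 1"
  shows "Re (v / (v - z)) > 1 / 2"
proof -
  have vz: "v \<noteq> z" using assms by auto
  have "Re (v / (v - z)) - 1/2 = (1 - (norm z)\<^sup>2) / (2 * (norm (v - z))\<^sup>2)"
  proof -
    define M where "M = Re v * Re (v - z) + Im v * Im (v - z)"
    define D where "D = (norm (v - z))\<^sup>2"
    have "(norm v)\<^sup>2 = 1" using assms by simp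
    then have v: "Re v * Re v + Im v * Im v = 1" unfolding cmod_power2 by (simp add: power2_eq_square)
    have D: "D > 0" using vz by (simp add: D_def)
    have "Re (v / (v - z)) = M / D"
      by (simp add: Re_divide cmod_power2 M_def D_def)
    then have "Re (v / (v - z)) - 1/2 = (2 * M - D) / (2 * D)"
      using D by (simp add: field_simps)
    also have "2 * M - D = 1 - (norm z)\<^sup>2"
      using v unfolding M_def D_def cmod_power2 by (simp add: power2_eq_square algebra_simps)
    finally show ?thesis by (simp add: D_def)
  qed
  moreover have "(norm z)\<^sup>2 < 1" using assms by (simp add: power_less_one_iff)
  ultimately show ?thesis using vz by (smt (verit) divide_pos_pos zero_less_norm_iff zero_less_power right_minus_eq)
qed

text \<open>Boundary case: the quotient is \<open>- 1 / (1 - u / v)\<close>, and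
  \<open>1 / (1 - s)\<close> sends the unit circle without \<open>1\<close> to the line
  \<open>Re = 1 / 2\<close>.\<close>

lemma Re_unit_div_diff_unit:
  assumes "norm u = 1" "norm v = 1" "u \<noteq> v"
  shows "Re (v / (u - v)) = - 1 / 2"
proof -
  have "(norm v)\<^sup>2 = 1" "(norm u)\<^sup>2 = 1" using assms by simp_all
  then have v: "Re v * Re v + Im v * Im v = 1" "Re u * Re u + Im u * Im u = 1"
    unfolding cmod_power2 by (simp_all add: power2_eq_square)
  define M where "M = Re v * Re (u - v) + Im v * Im (u - v)"
  define D where "D = (norm (u - v))\<^sup>2"
  have D: "D > 0" using assms by (simp add: D_def)
  have "Re (v / (u - v)) = M / D"
    by (simp add: Re_divide cmod_power2 M_def D_def)
  moreover have "2 * M = - D"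
    using v unfolding M_def D_def cmod_power2 by (simp add: power2_eq_square algebra_simps)
  ultimately have "Re (v / (u - v)) = (- D / 2) / D" by (metis nonzero_mult_div_cancel_left zero_neq_numeral)
  then show ?thesis using D by simp
qed

text \<open>For distinct \<open>u\<close> and \<open>v\<close>, the ratio
  \<open>(z - u) / (z - v)\<close> maps the disk into a half-plane with \<open>0\<close> on its
  boundary. Rotated into the right half-plane, it has a principal logarithm with imaginary part
  below \<open>pi / 2\<close> in modulus, which differs from \<open>Lu - Lv\<close> by a
  constant.\<close>

lemma log_difference_strip:
  assumes u: "norm u = 1" and v: "norm v = 1"
    and Lu: "\<And>z. z \<in> ball 0 1 \<Longrightarrow> (Lu has_field_derivative 1 / (z - u)) (at z)"
    and Lv: "\<And>z. z \<in> ball 0 1 \<Longrightarrow> (Lv has_field_derivative 1 / (z - v)) (at z)"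
  shows "\<exists>c. \<forall>z\<in>ball 0 1. \<bar>Im (Lu z - Lv z) - c\<bar> < pi / 2"
proof -
  \<comment> \<open>The factor \<open>v / (u - v)\<close> does the rotation: the product is
    \<open>v / (u - v) + v / (v - z)\<close>, with real parts \<open>- 1 / 2\<close> and more than
    \<open>1 / 2\<close>. For \<open>u = v\<close> that factor degenerates, but
    \<open>Lu - Lv\<close> is already constant, which the value \<open>1\<close> encodes.\<close>
  define X where "X z = (if u = v then 1 else (z - u) / (z - v) * (v / (u - v)))" for z
  have X: "Re (X z) > 0" if "z \<in> ball 0 1" for z
  proof (cases "u = v")
    case False
    have "z \<noteq> v" "z \<noteq> u" using that u v by auto
    then have "X z = v / (u - v) + v / (v - z)"
      using False unfolding X_def by (simp add: divide_simps) (simp add: algebra_simps)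
    then show ?thesis
      using Re_unit_div_diff_unit[OF u v False] Re_unit_div_diff[OF v, of z] that by simp
  qed (simp add: X_def)
  have "\<exists>C. \<forall>z\<in>ball 0 1. Lu z - Lv z - Ln (X z) = C"
  proof (rule has_field_derivative_zero_constant)
    fix z :: complex assume z: "z \<in> ball 0 1"
    have zuv: "z \<noteq> v" "z \<noteq> u" using z u v by auto
    have "((\<lambda>z. Ln (X z)) has_field_derivative 1 / (z - u) - 1 / (z - v)) (at z)"
    proof (cases "u = v")
      case False
      have v0: "v \<noteq> 0" using v by auto
      have "((\<lambda>z. (z - u) / (z - v)) has_field_derivative (1 * (z - v) - (z - u) * 1) / ((z - v) * (z - v))) (at z)"
        by (rule DERIV_divide) (use zuv in \<open>auto intro!: derivative_eq_intros\<close>)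
      then have "((\<lambda>z. (z - u) / (z - v) * (v / (u - v))) has_field_derivative
          (1 * (z - v) - (z - u) * 1) / ((z - v) * (z - v)) * (v / (u - v))) (at z)"
        by (rule DERIV_cmult_right)
      then have "(X has_field_derivative (u - v) / (z - v)\<^sup>2 * (v / (u - v))) (at z)"
        using False by (simp add: X_def[abs_def] power2_eq_square)
      moreover have "X z \<notin> \<real>\<^sub>\<le>\<^sub>0" using X[OF z] by (auto simp: complex_nonpos_Reals_iff)
      ultimately have "((\<lambda>z. Ln (X z)) has_field_derivative
          inverse (X z) * ((u - v) / (z - v)\<^sup>2 * (v / (u - v)))) (at z)"
        using DERIV_chain2[OF has_field_derivative_Ln] by blast
      moreover have "inverse (X z) * ((u - v) / (z - v)\<^sup>2 * (v / (u - v))) = 1 / (z - u) - 1 / (z - v)"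
      proof -
        have "inverse (X z) * ((u - v) / (z - v)\<^sup>2 * (v / (u - v))) = (u - v) / ((z - u) * (z - v))"
          using zuv False v0 by (simp add: X_def power2_eq_square)
        also have "\<dots> = 1 / (z - u) - 1 / (z - v)"
          using zuv by (simp add: diff_frac_eq)
        finally show ?thesis .
      qed
      ultimately show ?thesis by simp
    qed (simp add: X_def[abs_def])
    then have "((\<lambda>z. Lu z - Lv z - Ln (X z)) has_field_derivative
        1 / (z - u) - 1 / (z - v) - (1 / (z - u) - 1 / (z - v))) (at z)"
      by (intro DERIV_diff Lu Lv z)
    then show "((\<lambda>z. Lu z - Lv z - Ln (X z)) has_field_derivative 0) (at z within ball 0 1)"
      by (simp add: has_field_derivative_at_within)
  qed auto
  then obtain C where C: "\<And>z. z \<in> ball 0 1 \<Longrightarrow> Lu z - Lv z - Ln (X z) = C" by blast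
  have "\<bar>Im (Lu z - Lv z) - Im C\<bar> < pi / 2" if "z \<in> ball 0 1" for z
  proof -
    have "Im (Lu z - Lv z) - Im C = Im (Ln (X z))" using C[OF that] by (auto simp: algebra_simps)
    then show ?thesis
      using X[OF that] Re_Ln_pos_lt[of "X z"] by (metis less_irrefl zero_complex.sel(1))
  qed
  then show ?thesis by blast
qed

text \<open>Finiteness keeps the bound strict: the largest deviation is itself below
  \<open>B\<close>.\<close>

lemma abs_weighted_sum_less:
  fixes w d :: "'i \<Rightarrow> real"
  assumes fin: "finite K" and w: "\<And>k. k \<in> K \<Longrightarrow> w k \<ge> 0" "sum w K \<le> 1"
    and d: "\<And>k. k \<in> K \<Longrightarrow> \<bar>d k\<bar> < B" and B: "B > 0"
  shows "\<bar>\<Sum>k\<in>K. w k * d k\<bar> < B"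
proof -
  \<comment> \<open>Inserting \<open>0\<close> covers empty \<open>K\<close> and makes
    \<open>m\<close> nonnegative.\<close>
  define m where "m = Max (insert 0 ((\<lambda>k. \<bar>d k\<bar>) ` K))"
  have m: "0 \<le> m" "m < B" "\<And>k. k \<in> K \<Longrightarrow> \<bar>d k\<bar> \<le> m"
    using fin d B by (auto simp: m_def)
  have "\<bar>\<Sum>k\<in>K. w k * d k\<bar> \<le> (\<Sum>k\<in>K. w k * m)"
    by (rule order.trans[OF sum_abs])
      (auto intro!: sum_mono mult_left_mono simp: abs_mult w m)
  also have "\<dots> = sum w K * m" by (simp add: sum_distrib_right)
  also have "\<dots> \<le> m" using w(2) m(1) by (simp add: mult_left_le_one_le sum_nonneg w)
  finally show ?thesis using m(2) by simp
qed

text \<open>Equal masses can be paired off: the combination becomes a sum of differences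
  \<open>L j - L k\<close> with nonnegative weights of total \<open>sum \<mu> I\<close>. Each
  difference stays in a strip of half-width \<open>pi / 2\<close>, and total weight at most one does
  not widen it.\<close>

lemma log_combination_strip:
  fixes \<mu> \<nu> :: "'i \<Rightarrow> real" and L :: "'i \<Rightarrow> complex \<Rightarrow> complex"
  assumes fin: "finite I" and x: "\<And>k. k \<in> I \<Longrightarrow> norm (x k) = 1"
    and L: "\<And>k z. k \<in> I \<Longrightarrow> z \<in> ball 0 1 \<Longrightarrow> (L k has_field_derivative 1 / (z - x k)) (at z)"
    and \<mu>: "\<And>k. k \<in> I \<Longrightarrow> \<mu> k \<ge> 0" and \<nu>: "\<And>k. k \<in> I \<Longrightarrow> \<nu> k \<ge> 0"
    and s: "sum \<nu> I = sum \<mu> I" "sum \<mu> I \<le> 1"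
  shows "\<exists>c. \<forall>z\<in>ball 0 1. \<bar>Im (\<Sum>k\<in>I. of_real (\<mu> k - \<nu> k) * L k z) - c\<bar> < pi / 2"
\<comment> \<open>Zero mass is separate because the pairing weights divide by the mass.\<close>
proof (cases "sum \<mu> I = 0")
  case True
  then have "\<And>k. k \<in> I \<Longrightarrow> \<mu> k = 0" "\<And>k. k \<in> I \<Longrightarrow> \<nu> k = 0"
    using s \<mu> \<nu> fin by (simp_all add: sum_nonneg_eq_0_iff)
  then show ?thesis by (intro exI[of _ 0]) simp
next
  case False
  define N where "N = sum \<mu> I"
  have N: "N > 0" "N \<le> 1" "sum \<nu> I = N" "sum \<mu> I = N"
    using False s sum_nonneg[of I \<mu>] \<mu> unfolding N_def by force+
  have "\<exists>c. \<forall>z\<in>ball 0 1. \<bar>Im (L (fst p) z - L (snd p) z) - c\<bar> < pi / 2" if "p \<in> I \<times> I" for p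
    by (rule log_difference_strip[of "x (fst p)" "x (snd p)"]) (use x L that in auto)
  then obtain c where c: "\<And>p z. p \<in> I \<times> I \<Longrightarrow> z \<in> ball 0 1 \<Longrightarrow> \<bar>Im (L (fst p) z - L (snd p) z) - c p\<bar> < pi / 2"
    by metis
  \<comment> \<open>Product coupling: its marginals are \<mu> and \<nu>, since both have mass
    \<open>N\<close>.\<close>
  define w where "w p = \<mu> (fst p) * \<nu> (snd p) / N" for p
  have total: "sum w (I \<times> I) = N"
  proof -
    have "sum w (I \<times> I) = (\<Sum>j\<in>I. \<Sum>k\<in>I. \<mu> j * \<nu> k) / N"
      by (simp add: w_def sum.cartesian_product' sum_divide_distrib)
    also have "\<dots> = N * N / N"
      unfolding sum_product[symmetric] N(3,4) ..
    finally show ?thesis by simp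
  qed
  have pairs: "(\<Sum>k\<in>I. of_real (\<mu> k - \<nu> k) * L k z) = (\<Sum>p\<in>I \<times> I. of_real (w p) * (L (fst p) z - L (snd p) z))" for z
  proof -
    have "(\<Sum>p\<in>I \<times> I. of_real (w p) * (L (fst p) z - L (snd p) z)) =
       (\<Sum>j\<in>I. \<Sum>k\<in>I. of_real (\<mu> j) * L j z * (of_real (\<nu> k) / of_real N))
      - (\<Sum>j\<in>I. \<Sum>k\<in>I. (of_real (\<mu> j) / of_real N) * (of_real (\<nu> k) * L k z))"
      by (simp add: w_def sum.cartesian_product' sum_subtractf[symmetric] algebra_simps diff_divide_distrib)
    also have "\<dots> = (\<Sum>j\<in>I. of_real (\<mu> j) * L j z) * (of_real (sum \<nu> I) / of_real N)
       - (of_real (sum \<mu> I) / of_real N) * (\<Sum>k\<in>I. of_real (\<nu> k) * L k z)"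
      by (simp add: sum_product sum_divide_distrib)
    also have "\<dots> = (\<Sum>k\<in>I. of_real (\<mu> k - \<nu> k) * L k z)"
      using N by (simp add: sum_subtractf[symmetric] algebra_simps)
    finally show ?thesis by simp
  qed
  have "\<bar>Im (\<Sum>k\<in>I. of_real (\<mu> k - \<nu> k) * L k z) - (\<Sum>p\<in>I \<times> I. w p * c p)\<bar> < pi / 2"
    if z: "z \<in> ball 0 1" for z
  proof -
    have "Im (\<Sum>k\<in>I. of_real (\<mu> k - \<nu> k) * L k z) - (\<Sum>p\<in>I \<times> I. w p * c p)
       = (\<Sum>p\<in>I \<times> I. w p * (Im (L (fst p) z - L (snd p) z) - c p))"
      unfolding pairs by (simp add: sum_subtractf[symmetric] right_diff_distrib)
    also have "\<bar>\<dots>\<bar> < pi / 2"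
      by (rule abs_weighted_sum_less) (use fin total N c z \<mu> \<nu> in \<open>auto simp: w_def\<close>)
    finally show ?thesis .
  qed
  then show ?thesis by blast
qed

section \<open>Moving a point to the origin by a disk automorphism\<close>

text \<open>Up to a constant factor, \<open>exp H\<close> is the product of the
  \<open>z - x k\<close> to the powers \<open>- 2 * \<gamma> k\<close>, so its primitive is convex.
  Composition with an automorphism preserves this structure, which leaves only values equal to the
  one at \<open>0\<close> to be excluded.\<close>

lemma inj_on_ball_if_close_to_product:
  fixes \<gamma> :: "'i \<Rightarrow> real" and H :: "complex \<Rightarrow> complex"
  assumes fin: "finite I" and x: "\<And>k. k \<in> I \<Longrightarrow> norm (x k) = 1"
    and \<gamma>: "\<And>k. k \<in> I \<Longrightarrow> \<gamma> k \<ge> 0" "sum \<gamma> I = 1"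
    and H: "\<And>z. z \<in> ball 0 1 \<Longrightarrow>
      (H has_field_derivative (\<Sum>k\<in>I. of_real (- 2 * \<gamma> k) * (1 / (z - x k)))) (at z)"
    and f: "\<And>z. z \<in> ball 0 1 \<Longrightarrow> (f has_field_derivative f' z) (at z)"
    and close: "\<And>z. z \<in> ball 0 1 \<Longrightarrow> Re (f' z / exp (H z)) > 0"
  shows "inj_on f (ball 0 1)"
proof (rule inj_onI, rule ccontr)
  fix a b assume ab: "a \<in> ball 0 1" "b \<in> ball 0 1" "f a = f b" "a \<noteq> b"
  have a: "norm a < 1" and b: "norm b < 1" using ab by auto
  have "H holomorphic_on ball 0 1"
    using H by (meson holomorphic_on_open open_ball)
  then have "(\<lambda>z. exp (H z)) holomorphic_on ball 0 1"
    by (intro holomorphic_intros)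
  then obtain g where g: "\<And>z. z \<in> ball 0 1 \<Longrightarrow> (g has_field_derivative exp (H z)) (at z)"
    using holomorphic_convex_primitive'[of "ball 0 1" "\<lambda>z. exp (H z)"] at_within_open[OF _ open_ball]
    by (metis convex_ball open_ball)
  have den: "1 + cnj a * z \<noteq> 0" if "norm z < 1" for z
  proof
    assume "1 + cnj a * z = 0"
    then have "cnj a * z = - 1" by (simp add: eq_neg_iff_add_eq_0 add.commute)
    then have "norm a * norm z = 1" by (metis complex_mod_cnj norm_minus_cancel norm_mult norm_one)
    moreover have "norm a * norm z < 1 * 1" using a that by (intro mult_strict_mono') auto
    ultimately show False by simp
  qed
  \<comment> \<open>The automorphism taking \<open>0\<close> to \<open>a\<close>; \<open>R\<close>
    is \<open>1 - (norm a)^2\<close>, the numerator of its derivative.\<close>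
  define \<phi> where "\<phi> z = (z + a) / (1 + cnj a * z)" for z
  define R where "R = 1 - a * cnj a"
  define \<phi>' where "\<phi>' z = R / (1 + cnj a * z)\<^sup>2" for z
  have \<phi>_Moebius: "\<phi> = (\<lambda>z. Moebius_function 0 (- a) z)"
    by (auto simp: \<phi>_def Moebius_function_def)
  have \<phi>: "\<phi> z \<in> ball 0 1" if "z \<in> ball 0 1" for z
    unfolding \<phi>_Moebius using that a Moebius_function_norm_lt_1[of "- a" z 0] by simp
  have R0: "R \<noteq> 0"
  proof
    assume "R = 0"
    then have "(norm a)\<^sup>2 = 1"
      unfolding R_def by (metis complex_norm_square eq_iff_diff_eq_0 of_real_eq_1_iff)
    then show False using a by (simp add: power_less_one_iff[of "norm a" 2, THEN iffD2, THEN less_imp_neq])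
  qed
  have d\<phi>: "(\<phi> has_field_derivative \<phi>' z) (at z)" if "z \<in> ball 0 1" for z
  proof -
    have "(\<phi> has_field_derivative (1 * (1 + cnj a * z) - (z + a) * cnj a) / ((1 + cnj a * z) * (1 + cnj a * z))) (at z)"
      unfolding \<phi>_def[abs_def] by (rule DERIV_divide) (use den that in \<open>auto intro!: derivative_eq_intros\<close>)
    then show ?thesis by (simp add: \<phi>'_def R_def power2_eq_square algebra_simps)
  qed
  \<comment> \<open>\<open>h\<close> is the derivative of \<open>H\<close>; \<open>G'\<close> and
    \<open>G''\<close> are the first two derivatives of \<open>g (\<phi> z)\<close>, the second
    written as \<open>G'\<close> times its logarithmic derivative.\<close>
  define h where "h z = (\<Sum>k\<in>I. of_real (- 2 * \<gamma> k) * (1 / (z - x k)))" for z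
  define G' where "G' z = exp (H (\<phi> z)) * \<phi>' z" for z
  define G'' where "G'' z = G' z * (h (\<phi> z) * \<phi>' z - 2 * cnj a / (1 + cnj a * z))" for z
  define \<zeta> where "\<zeta> = (b - a) / (1 - cnj a * b)"
  have \<zeta>_eq: "\<zeta> = Moebius_function 0 a b" by (simp add: \<zeta>_def Moebius_function_def)
  have \<zeta>: "\<zeta> \<in> ball 0 1" using a b Moebius_function_norm_lt_1[of a b 0] by (simp add: \<zeta>_eq)
  have \<phi>\<zeta>: "\<phi> \<zeta> = b"
    unfolding \<phi>_Moebius \<zeta>_eq using Moebius_function_compose[of "- a" a b] a b by simp
  have \<zeta>0: "\<zeta> \<noteq> 0"
    using \<phi>\<zeta> ab(4) by (auto simp: \<phi>_def)
  have nz: "G' z \<noteq> 0" if "z \<in> ball 0 1" for z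
    using R0 den[of z] that by (simp add: G'_def \<phi>'_def)
  have "f (\<phi> \<zeta>) \<noteq> f (\<phi> 0)"
  proof (rule close_to_convex_value_at_0[where f = "\<lambda>z. f (\<phi> z)" and g = "\<lambda>z. g (\<phi> z)"
        and f' = "\<lambda>z. f' (\<phi> z) * \<phi>' z" and g' = G' and g'' = G''])
    fix z :: complex assume z: "z \<in> ball 0 1"
    have z1: "norm z < 1" using z by simp
    note D = den[OF z1]
    show "((\<lambda>z. f (\<phi> z)) has_field_derivative f' (\<phi> z) * \<phi>' z) (at z)"
      using DERIV_chain2[OF f[OF \<phi>[OF z]] d\<phi>[OF z]] .
    show "((\<lambda>z. g (\<phi> z)) has_field_derivative G' z) (at z)"
      unfolding G'_def using DERIV_chain2[OF g[OF \<phi>[OF z]] d\<phi>[OF z]] .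
    show "G' z \<noteq> 0" using nz[OF z] .
    show "Re (f' (\<phi> z) * \<phi>' z / G' z) > 0"
      using close[OF \<phi>[OF z]] nz[OF z] by (simp add: G'_def)
    have "((\<lambda>z. exp (H (\<phi> z))) has_field_derivative exp (H (\<phi> z)) * (h (\<phi> z) * \<phi>' z)) (at z)"
      using DERIV_fun_exp[OF DERIV_chain2[OF H[OF \<phi>[OF z]] d\<phi>[OF z]]] by (simp add: h_def)
    moreover have "(\<phi>' has_field_derivative \<phi>' z * (- 2 * cnj a / (1 + cnj a * z))) (at z)"
    proof -
      have "((\<lambda>z. R / (1 + cnj a * z)\<^sup>2) has_field_derivative
          (0 * (1 + cnj a * z)\<^sup>2 - R * (2 * (1 + cnj a * z) * cnj a)) / ((1 + cnj a * z)\<^sup>2 * (1 + cnj a * z)\<^sup>2)) (at z)"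
        by (rule DERIV_divide) (use D in \<open>auto intro!: derivative_eq_intros\<close>)
      moreover have "(0 * (1 + cnj a * z)\<^sup>2 - R * (2 * (1 + cnj a * z) * cnj a)) / ((1 + cnj a * z)\<^sup>2 * (1 + cnj a * z)\<^sup>2)
          = \<phi>' z * (- 2 * cnj a / (1 + cnj a * z))"
        using D unfolding \<phi>'_def by (simp only: mult_zero_left diff_0 power2_eq_square) (simp add: divide_simps)
      ultimately show ?thesis by (simp add: \<phi>'_def[abs_def])
    qed
    ultimately show "(G' has_field_derivative G'' z) (at z)"
      unfolding G'_def[abs_def] G''_def
      by (rule DERIV_cong[OF DERIV_mult]) (simp add: G'_def algebra_simps)
    \<comment> \<open>The preimage of \<open>x k\<close> under \<phi>, again on the unit circle
      because \<open>norm (1 - cnj a * x k) = norm (x k - a)\<close>.\<close>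
    define y where "y k = (x k - a) / (1 - cnj a * x k)" for k
    have y: "norm (y k) = 1" and pole_term: "\<phi>' z / (\<phi> z - x k) + cnj a / (1 + cnj a * z) = - 1 / (y k - z)"
      if k: "k \<in> I" for k
    proof -
      have xx: "x k * cnj (x k) = 1" using x[OF k] by (simp add: complex_norm_square[symmetric])
      have x0: "x k \<noteq> 0" using x[OF k] by auto
      have "1 - cnj a * x k = x k * cnj (x k - a)" using xx by (simp add: algebra_simps)
      then have n: "norm (1 - cnj a * x k) = norm (x k - a)" using x[OF k] by (simp add: norm_mult del: complex_cnj_diff)
      have xa: "x k - a \<noteq> 0" using x[OF k] a by auto
      then have dk: "1 - cnj a * x k \<noteq> 0" using n by auto
      show y1: "norm (y k) = 1" using n xa by (simp add: y_def norm_divide)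
      have yz: "y k \<noteq> z" using y1 z1 by auto
      \<comment> \<open>\<open>\<phi> z - x k\<close> is a constant times
        \<open>(z - y k) / (1 + cnj a * z)\<close>. In its logarithmic derivative the added term
        cancels the contribution of the denominator.\<close>
      define E where "E = z + a - x k - cnj a * z * x k"
      have E: "E = (z - y k) * (1 - cnj a * x k)" using dk by (simp add: y_def E_def field_simps)
      have E0: "E \<noteq> 0" using E yz dk by simp
      have "\<phi> z - x k = E / (1 + cnj a * z)" using D by (simp add: \<phi>_def E_def field_simps)
      then have "\<phi>' z / (\<phi> z - x k) = R / ((1 + cnj a * z) * E)"
        using D by (simp add: \<phi>'_def power2_eq_square)
      then have "\<phi>' z / (\<phi> z - x k) + cnj a / (1 + cnj a * z)
          = (R + cnj a * E) / ((1 + cnj a * z) * E)"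
        using E0 by (simp add: add_divide_distrib)
      also have "R + cnj a * E = (1 + cnj a * z) * (1 - cnj a * x k)"
        by (simp add: R_def E_def algebra_simps)
      also have "\<dots> / ((1 + cnj a * z) * E) = - 1 / (y k - z)"
      proof -
        have "(1 + cnj a * z) * (1 - cnj a * x k) / ((1 + cnj a * z) * E) = 1 / (z - y k)"
          using D dk unfolding E by simp
        then show ?thesis by (metis minus_diff_eq minus_divide_divide)
      qed
      finally show "\<phi>' z / (\<phi> z - x k) + cnj a / (1 + cnj a * z) = - 1 / (y k - z)" .
    qed
    \<comment> \<open>Total mass one lets the term \<open>- 2 * cnj a / (1 + cnj a * z)\<close>
      coming from \<open>\<phi>'\<close> be shared among the factors, as \<open>pole_term\<close>
      needs.\<close>
    have one: "(\<Sum>k\<in>I. complex_of_real (\<gamma> k)) = 1" using \<gamma>(2) by (metis of_real_1 of_real_sum)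
    have "1 + z * G'' z / G' z = 1 + z * (h (\<phi> z) * \<phi>' z - 2 * cnj a / (1 + cnj a * z))"
      using nz[OF z] by (simp add: G''_def)
    also have "\<dots> = (\<Sum>k\<in>I. of_real (\<gamma> k)) * (1 - 2 * z * (cnj a / (1 + cnj a * z)))
        + z * (h (\<phi> z) * \<phi>' z)"
      unfolding one by (simp add: algebra_simps)
    also have "z * (h (\<phi> z) * \<phi>' z) = (\<Sum>k\<in>I. of_real (\<gamma> k) * (- 2 * z * (\<phi>' z / (\<phi> z - x k))))"
      unfolding h_def sum_distrib_left sum_distrib_right by (rule sum.cong) auto
    also have "(\<Sum>k\<in>I. of_real (\<gamma> k)) * (1 - 2 * z * (cnj a / (1 + cnj a * z))) + \<dots>
        = (\<Sum>k\<in>I. of_real (\<gamma> k) * (1 - 2 * z * (\<phi>' z / (\<phi> z - x k) + cnj a / (1 + cnj a * z))))"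
      unfolding sum_distrib_right sum.distrib[symmetric]
      by (rule sum.cong) (simp_all only: distrib_left right_diff_distrib, simp_all)
    \<comment> \<open>Each bracket is \<open>1 + 2 * z / (y k - z)\<close>; in this form
      \<open>Re_unit_div_diff\<close> gives it positive real part.\<close>
    also have "\<dots> = (\<Sum>k\<in>I. of_real (\<gamma> k) * (2 * (y k / (y k - z)) - 1))"
    proof (rule sum.cong[OF refl])
      fix k assume k: "k \<in> I"
      have "y k \<noteq> z" using y[OF k] z1 by auto
      then show "of_real (\<gamma> k) * (1 - 2 * z * (\<phi>' z / (\<phi> z - x k) + cnj a / (1 + cnj a * z)))
         = of_real (\<gamma> k) * (2 * (y k / (y k - z)) - 1)"
        unfolding pole_term[OF k] by (simp add: field_simps)
    qed
    finally have sum_eq: "1 + z * G'' z / G' z = (\<Sum>k\<in>I. of_real (\<gamma> k) * (2 * (y k / (y k - z)) - 1))" .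
    have Re_term: "Re (of_real r * (2 * u - 1)) = r * (2 * Re u - 1)" for r u by simp
    have "Re (1 + z * G'' z / G' z) = (\<Sum>k\<in>I. \<gamma> k * (2 * Re (y k / (y k - z)) - 1))"
      unfolding sum_eq Re_sum Re_term ..
    also have "\<dots> > 0"
    proof -
      have pos: "2 * Re (y k / (y k - z)) - 1 > 0" if "k \<in> I" for k
        using Re_unit_div_diff[OF y[OF that] z1] by simp
      obtain k where k: "k \<in> I" "\<gamma> k \<noteq> 0"
        using \<gamma>(2) by (metis sum.neutral zero_neq_one)
      show ?thesis
        by (rule sum_pos2[OF fin k(1)])
          (use pos \<gamma>(1) k in \<open>auto intro!: mult_nonneg_nonneg mult_pos_pos simp: less_le\<close>)
    qed
    finally show "Re (1 + z * G'' z / G' z) > 0" .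
  qed (use \<zeta> \<zeta>0 in auto)
  then show False using \<phi>\<zeta> ab(3) by (simp add: \<phi>_def)
qed

section \<open>Splitting the exponents and conclusion\<close>

theorem theorem4:
  fixes n :: nat and t \<beta> :: "nat \<Rightarrow> real" and z :: "nat \<Rightarrow> complex"
    and g :: "nat \<Rightarrow> complex \<Rightarrow> complex" and a :: complex and f :: "complex \<Rightarrow> complex"
  assumes "0 \<le> t 1" and "strict_mono_on {1..n+1} t" and "t (n+1) < 2 * pi"
    and "\<And>k. k \<in> {1..n+1} \<Longrightarrow> z k = exp (\<i> * complex_of_real (t k))"
    and "(\<Sum>k=1..n+1. \<beta> k) = 1"
    and "(\<Sum>k=1..n+1. \<bar>\<beta> k\<bar>) \<le> 2"
    and "\<And>k. k \<in> {1..n+1} \<Longrightarrow> power_branch_on (ball 0 1) (\<lambda>w. w - z k) (- 2 * \<beta> k) (g k)"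
    and "a \<noteq> 0"
    and "f analytic_on ball 0 1"
    and "\<And>w. w \<in> ball 0 1 \<Longrightarrow> deriv f w = a * (\<Prod>k=1..n+1. g k w)"
  shows "inj_on f (ball 0 1)"
proof -
  define I where "I = {1..n+1}"
  have fin: "finite I" by (simp add: I_def)
  have z: "norm (z k) = 1" if "k \<in> I" for k
    using assms(4)[of k] that by (simp add: I_def)
  obtain L where L: "\<And>k. k \<in> I \<Longrightarrow> L k analytic_on ball 0 1"
      "\<And>k w. k \<in> I \<Longrightarrow> w \<in> ball 0 1 \<Longrightarrow> exp (L k w) = w - z k"
      "\<And>k w. k \<in> I \<Longrightarrow> w \<in> ball 0 1 \<Longrightarrow> g k w = exp (of_real (- 2 * \<beta> k) * L k w)"
    using assms(7) unfolding power_branch_on_def I_def[symmetric] by metis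
  \<comment> \<open>Differentiating \<open>exp (L k w) = w - z k\<close> shows that the derivative
    is independent of the branch.\<close>
  have dL: "(L k has_field_derivative 1 / (w - z k)) (at w)" if k: "k \<in> I" and w: "w \<in> ball 0 1" for k w
  proof -
    have d: "(L k has_field_derivative deriv (L k) w) (at w)"
      using L(1)[OF k] w by (meson analytic_imp_holomorphic holomorphic_derivI open_ball)
    have "((\<lambda>w. exp (L k w)) has_field_derivative 1) (at w)"
      by (rule has_field_derivative_transform_within_open[where S="ball 0 1" and f="\<lambda>w. w - z k"])
        (use w L(2)[OF k] in \<open>auto intro!: derivative_eq_intros\<close>)
    then have "exp (L k w) * deriv (L k) w = 1"
      using DERIV_fun_exp[OF d] DERIV_unique by blast
    then have "deriv (L k) w = 1 / exp (L k w)" by (simp add: field_simps)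
    then show ?thesis using d L(2)[OF k w] by simp
  qed
  define P where "P = (\<Sum>k\<in>I. max (\<beta> k) 0)"
  have P: "1 \<le> P" "P \<le> 3 / 2"
  proof -
    \<comment> \<open>Twice the positive part is the number plus its absolute value; here the sums
      are \<open>1\<close> and a number between \<open>1\<close> and \<open>2\<close>.\<close>
    have "2 * P = (\<Sum>k\<in>I. \<beta> k) + (\<Sum>k\<in>I. \<bar>\<beta> k\<bar>)"
      unfolding P_def sum_distrib_left sum.distrib[symmetric] by (rule sum.cong) auto
    moreover have "(\<Sum>k\<in>I. \<bar>\<beta> k\<bar>) \<ge> \<bar>\<Sum>k\<in>I. \<beta> k\<bar>" by (rule sum_abs)
    ultimately show "1 \<le> P" "P \<le> 3 / 2" using assms(5,6) unfolding I_def by auto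
  qed
  define \<gamma> where "\<gamma> k = max (\<beta> k) 0 / P" for k
  \<comment> \<open>The exponents of \<open>f' / g'\<close> are \<open>\<mu> k - \<nu> k\<close>:
    \<mu> comes from the negative parts, \<nu> from the excess of the positive parts over \<gamma>,
    nonnegative because \<open>P >= 1\<close>.\<close>
  define \<mu> where "\<mu> k = 2 * max (- \<beta> k) 0" for k
  define \<nu> where "\<nu> k = 2 * (max (\<beta> k) 0 - \<gamma> k)" for k
  have \<gamma>0: "\<gamma> k \<ge> 0" for k using P by (simp add: \<gamma>_def)
  have \<gamma>1: "sum \<gamma> I = 1" using P unfolding \<gamma>_def P_def by (simp add: sum_divide_distrib[symmetric])
  have \<nu>0: "\<nu> k \<ge> 0" for k
    using P by (simp add: \<nu>_def \<gamma>_def divide_le_eq mult_le_cancel_left1)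
  have \<nu>s: "sum \<nu> I = 2 * P - 2"
    using \<gamma>1 by (simp add: \<nu>_def P_def sum_subtractf sum_distrib_left[symmetric])
  have \<mu>\<nu>: "\<mu> k - \<nu> k = - 2 * (\<beta> k - \<gamma> k)" for k by (simp add: \<mu>_def \<nu>_def max_def)
  have "sum \<mu> I - sum \<nu> I = - 2 * (sum \<beta> I - sum \<gamma> I)"
    unfolding sum_subtractf[symmetric] \<mu>\<nu> sum_distrib_left ..
  then have \<mu>s: "sum \<nu> I = sum \<mu> I" using \<gamma>1 assms(5) by (simp add: I_def)
  have "\<exists>c. \<forall>w\<in>ball 0 1. \<bar>Im (\<Sum>k\<in>I. of_real (\<mu> k - \<nu> k) * L k w) - c\<bar> < pi / 2"
  proof (rule log_combination_strip[OF fin z dL _ \<nu>0 \<mu>s])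
    \<comment> \<open>The common mass is \<open>2 * P - 2\<close>, so this is where the bound on the
      absolute values enters.\<close>
    show "sum \<mu> I \<le> 1" using \<mu>s \<nu>s P(2) by simp
  qed (simp_all add: \<mu>_def)
  then obtain c where c: "\<And>w. w \<in> ball 0 1 \<Longrightarrow> \<bar>Im (\<Sum>k\<in>I. of_real (\<mu> k - \<nu> k) * L k w) - c\<bar> < pi / 2"
    by blast
  define H where "H w = (\<Sum>k\<in>I. of_real (- 2 * \<gamma> k) * L k w)" for w
  \<comment> \<open>This factor cancels \<open>a\<close> and turns the centre \<open>c\<close> of
    the strip to \<open>0\<close>; being nonzero, it does not affect injectivity.\<close>
  define \<kappa> where "\<kappa> = exp (- \<i> * of_real c) / a"
  have \<kappa>: "\<kappa> \<noteq> 0" using assms(8) by (simp add: \<kappa>_def)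
  have "inj_on (\<lambda>w. \<kappa> * f w) (ball 0 1)"
  proof (rule inj_on_ball_if_close_to_product[OF fin z \<gamma>0 \<gamma>1, where H = H and f' = "\<lambda>w. \<kappa> * deriv f w"])
    fix w :: complex assume w: "w \<in> ball 0 1"
    show "(H has_field_derivative (\<Sum>k\<in>I. of_real (- 2 * \<gamma> k) * (1 / (w - z k)))) (at w)"
      unfolding H_def[abs_def] by (intro DERIV_sum DERIV_cmult dL w)
    show "((\<lambda>w. \<kappa> * f w) has_field_derivative \<kappa> * deriv f w) (at w)"
      using assms(9) w by (intro DERIV_cmult) (meson analytic_imp_holomorphic holomorphic_derivI open_ball)
    define T where "T = (\<Sum>k\<in>I. of_real (\<mu> k - \<nu> k) * L k w)"
    have "deriv f w = a * exp (\<Sum>k\<in>I. of_real (- 2 * \<beta> k) * L k w)"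
      using assms(10)[OF w] L(3)[OF _ w] fin by (simp add: I_def[symmetric] exp_sum del: One_nat_def)
    also have "(\<Sum>k\<in>I. of_real (- 2 * \<beta> k) * L k w) = T + H w"
      unfolding T_def H_def \<mu>\<nu> sum.distrib[symmetric] by (rule sum.cong) (auto simp: algebra_simps)
    finally have "\<kappa> * deriv f w / exp (H w) = exp (T - \<i> * of_real c)"
      using assms(8) by (simp add: \<kappa>_def exp_add exp_diff exp_minus field_simps)
    \<comment> \<open>The real part of \<open>exp (T - \<i> * c)\<close> is
      \<open>exp (Re T) * cos (Im T - c)\<close>.\<close>
    moreover have "cos (Im T - c) > 0"
      using c[OF w] unfolding T_def[symmetric] by (intro cos_gt_zero_pi) linarith+
    ultimately show "Re (\<kappa> * deriv f w / exp (H w)) > 0"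
      by (simp add: Re_exp)
  qed auto
  then show ?thesis by (auto simp: inj_on_def \<kappa>)
qed

end
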